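(* Let $\lambda$ be a partition of rank $\rho$, let $R=\mathbb{Z}[x_{ij}\colon (i,j)\in\lambda]$, and let $M(1,1)$ be the $(\rho+1)\times(\rho+1)$ matrix $(P_{rs})_{1\le r,s\le \rho+1}$ over $R$. Then there are an upper unitriangular matrix $P$ and a lower unitriangular matrix $Q$ in $\mathrm{SL}(\rho+1,R)$ such that $$P\cdot M(1,1)\cdot Q=\mathrm{diag}(A_{11},A_{22},\dots,A_{\rho+1,\rho+1}).$$ In particular, $\det M(1,1)=A_{11}A_{22}\cdots A_{\rho\rho}$ (since $A_{\rho+1,\rho+1}=1$).
   Context: A partition $\lambda=(\lambda_1\ge\lambda_2\ge\dots\ge\lambda_\ell>0)$ is identified with its Young diagram $\{(r,s)\colon 1\le r\le \ell,\ 1\le s\le\lambda_r\}$, where $(r,s)$ is the square in row $r$ and column $s$. The rank $\rho$ of $\lambda$ is the number of squares on its main diagonal, i.e. the largest $k$ with $\lambda_k\ge k$ ($\rho=0$ if $\lambda=\emptyset$). The extended partition $\lambda^*$ is obtained by adjoining to $\lambda$ the border strip from the end of the first row to the end of the first column; explicitly $\lambda^*$ is the diagram of the partition with parts $\lambda^*_1=\lambda_1+1$ and $\lambda^*_r=\lambda_{r-1}+1$ for $2\le r\le \ell+1$ (so $\emptyset^*=(1)$). Associate to each square $(i,j)\in\lambda$ an indeterminate $x_{ij}$. For $(r,s)\in\lambda^*$ let $\lambda(r,s)$ be the partition whose diagram consists of all squares $(u,v)\in\lambda$ with $u\ge r$, $v\ge s$ (so $\lambda(r,s)=\emptyset$ if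 $(r,s)\in\lambda^*\setminus\lambda$). Define $$P_{rs}=\sum_{\mu\subseteq\lambda(r,s)}\ \prod_{(i,j)\in\lambda(r,s)\setminus\mu}x_{ij},$$ the sum over all partitions $\mu$ whose diagram is contained in $\lambda(r,s)$ (so $P_{rs}=1$ for $(r,s)\in\lambda^*\setminus\lambda$), and $A_{rs}=\prod_{(i,j)\in\lambda(r,s)}x_{ij}$ (empty product $=1$). The square $\{(r,s)\colon 1\le r,s\le\rho+1\}$ lies in $\lambda^*$. *)

theory Defs
  imports "Jordan_Normal_Form.Determinant" "HOL-Library.Poly_Mapping"
begin

text \<open>A partition is the list of its nonzero parts in weakly decreasing order; squares are
  numbered from 1, as in matrix coordinates.\<close>

definition is_partition :: "nat list \<Rightarrow> bool" where
  "is_partition la \<longleftrightarrow> sorted_wrt (\<ge>) la \<and> 0 \<notin> set la"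

definition diagram :: "nat list \<Rightarrow> (nat \<times> nat) set" where
  "diagram la = {(i, j). 1 \<le> i \<and> i \<le> length la \<and> 1 \<le> j \<and> j \<le> la ! (i - 1)}"

definition part_rank :: "nat list \<Rightarrow> nat" where
  "part_rank la = card {k. (k, k) \<in> diagram la}"

text \<open>The squares of \<open>\<lambda>(r,s)\<close>, kept at their original position in \<open>\<lambda>\<close> because
  their indeterminates are those of \<open>\<lambda>\<close>.\<close>

definition subdiagram :: "nat list \<Rightarrow> nat \<Rightarrow> nat \<Rightarrow> (nat \<times> nat) set" where
  "subdiagram la r s = {(u, v) \<in> diagram la. r \<le> u \<and> s \<le> v}"

text \<open>The diagram of \<open>\<mu>\<close>, translated so that its corner \<open>(1,1)\<close> lies on \<open>(r,s)\<close>.\<close>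

definition placed :: "nat list \<Rightarrow> nat \<Rightarrow> nat \<Rightarrow> (nat \<times> nat) set" where
  "placed mu r s = (\<lambda>(u, v). (u + r - 1, v + s - 1)) ` diagram mu"

definition parts_in :: "nat list \<Rightarrow> nat \<Rightarrow> nat \<Rightarrow> nat list set" where
  "parts_in la r s = {mu. is_partition mu \<and> placed mu r s \<subseteq> subdiagram la r s}"

text \<open>Integer polynomials in indeterminates indexed by all pairs of naturals: finitely supported
  maps from monomials (finitely supported exponent maps) to coefficients, with convolution as
  multiplication. The ring of the partition is the subring of the polynomials that involve only
  indeterminates attached to squares of the diagram.\<close>

type_synonym xpoly = "((nat \<times> nat) \<Rightarrow>\<^sub>0 nat) \<Rightarrow>\<^sub>0 int"

definition X :: "nat \<times> nat \<Rightarrow> xpoly" where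
  "X p = Poly_Mapping.single (Poly_Mapping.single p 1) 1"

definition poly_ring :: "nat list \<Rightarrow> xpoly set" where
  "poly_ring la = {f. \<forall>m \<in> Poly_Mapping.keys f. Poly_Mapping.keys m \<subseteq> diagram la}"

definition P_entry :: "nat list \<Rightarrow> nat \<Rightarrow> nat \<Rightarrow> xpoly" where
  "P_entry la r s = (\<Sum>mu \<in> parts_in la r s. \<Prod>p \<in> subdiagram la r s - placed mu r s. X p)"

definition A_entry :: "nat list \<Rightarrow> nat \<Rightarrow> nat \<Rightarrow> xpoly" where
  "A_entry la r s = (\<Prod>p \<in> subdiagram la r s. X p)"

text \<open>Matrix indices start at 0.\<close>

definition M11 :: "nat list \<Rightarrow> xpoly mat" where
  "M11 la = Matrix.mat (part_rank la + 1) (part_rank la + 1)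
     (\<lambda>(i, j). P_entry la (i + 1) (j + 1))"

text \<open>\<open>S\<close> is meant to be (the carrier of) a subring of the coefficient type.\<close>

definition SL :: "nat \<Rightarrow> 'a :: comm_ring_1 set \<Rightarrow> 'a mat set" where
  "SL n S = {B \<in> carrier_mat n n. elements_mat B \<subseteq> S \<and> Determinant.det B = 1}"

definition upper_unitriangular :: "'a :: {zero, one} mat \<Rightarrow> bool" where
  "upper_unitriangular B \<longleftrightarrow>
     square_mat B \<and> upper_triangular B \<and> (\<forall>i < dim_row B. B $$ (i, i) = 1)"

definition lower_unitriangular :: "'a :: {zero, one} mat \<Rightarrow> bool" where
  "lower_unitriangular B \<longleftrightarrow> upper_unitriangular (transpose_mat B)"

lemma finite_diagram: "finite (diagram la)"
proof (rule finite_subset)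
  show "diagram la \<subseteq> {..length la} \<times> {..sum_list la}"
    unfolding diagram_def
    by (auto intro: order_trans[OF _ elem_le_sum_list])
qed simp

text \<open>Hence the sum in the definition of the matrix entries ranges over a finite set.\<close>

lemma finite_parts_in:
  assumes "1 \<le> r" "1 \<le> s"
  shows "finite (parts_in la r s)"
proof (rule finite_subset)
  show "parts_in la r s \<subseteq> {mu. set mu \<subseteq> {..sum_list la} \<and> length mu \<le> length la}"
  proof
    fix mu assume "mu \<in> parts_in la r s"
    then have mu: "0 \<notin> set mu" "placed mu r s \<subseteq> diagram la"
      by (auto simp: parts_in_def is_partition_def subdiagram_def)
    have row: "i + r \<le> length la \<and> mu ! i \<le> sum_list la" if i: "i < length mu" for i
    proof -
      have "mu ! i \<noteq> 0"
        using i mu(1) by (metis nth_mem)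
      then have "(i + 1, mu ! i) \<in> diagram mu"
        using i by (auto simp: diagram_def)
      then have "(i + 1 + r - 1, mu ! i + s - 1) \<in> placed mu r s"
        unfolding placed_def by force
      then have "(i + r, mu ! i + s - 1) \<in> diagram la"
        using mu(2) by auto
      then have "i + r \<le> length la" "mu ! i + s - 1 \<le> la ! (i + r - 1)" "i + r - 1 < length la"
        using assms by (auto simp: diagram_def)
      moreover from this have "la ! (i + r - 1) \<le> sum_list la"
        by (intro elem_le_sum_list)
      ultimately show ?thesis
        using assms by linarith
    qed
    have "length mu \<le> length la"
      using row[of "length mu - 1"] assms by (cases "length mu") auto
    moreover have "set mu \<subseteq> {..sum_list la}"
      using row by (auto simp: in_set_conv_nth)
    ultimately show "mu \<in> {mu. set mu \<subseteq> {..sum_list la} \<and> length mu \<le> length la}"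
      by simp
  qed
  show "finite {mu. set mu \<subseteq> {..sum_list la} \<and> length mu \<le> length la}"
    by (rule finite_lists_length_le) simp
qed

end

theory Submission
  imports Defs
begin

text \<open>
  Let \<open>\<mu> \<subseteq> \<lambda>(r,s)\<close> and let \<open>k \<ge> max r s\<close> be least such that \<open>(k,k) \<notin> \<mu>\<close>. Then \<open>\<mu>\<close> contains
  all squares \<open>(u,v)\<close> with \<open>r \<le> u < k\<close> and \<open>s \<le> v < k\<close> and none with \<open>u, v \<ge> k\<close>, while its parts in
  the arm \<open>{r \<le> u < k \<le> v}\<close> and in the leg \<open>{s \<le> v < k \<le> u}\<close> can be chosen independently.
  Summing over \<open>k\<close> gives \<open>P_rs = (\<Sum>k. U_rk * A_kk * L_ks)\<close>, where \<open>U_rk\<close> depends only on the arm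
  and \<open>L_ks\<close> only on the leg. So \<open>M(1,1) = U D L\<close> with \<open>U\<close> upper and \<open>L\<close> lower unitriangular, and
  the theorem holds with \<open>P\<close>, \<open>Q\<close> the inverses of \<open>U\<close>, \<open>L\<close>, whose entries are polynomials in those
  of \<open>U\<close>, \<open>L\<close>.
\<close>

section \<open>Partitions as down-sets\<close>

lemma diagram_down_closed:
  assumes "is_partition la" "(u, v) \<in> diagram la" "1 \<le> u'" "u' \<le> u" "1 \<le> v'" "v' \<le> v"
  shows "(u', v') \<in> diagram la"
proof -
  have "la ! (u - 1) \<le> la ! (u' - 1)"
  proof (cases "u' = u")
    case False
    then have "u' - 1 < u - 1" "u - 1 < length la"
      using assms by (auto simp: diagram_def)
    then show ?thesis
      using assms(1) by (auto simp: is_partition_def sorted_wrt_iff_nth_less)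
  qed simp
  then show ?thesis
    using assms by (auto simp: diagram_def)
qed

text \<open>Along a row, a column or the diagonal, a down-closed set of squares reaches without gaps
  up to its maximum. This turns cardinalities into end points.\<close>

lemma down_closed_eq_interval:
  fixes A :: "nat set"
  assumes "finite A" "A \<subseteq> {s..}" "\<And>v v'. v \<in> A \<Longrightarrow> s \<le> v' \<Longrightarrow> v' \<le> v \<Longrightarrow> v' \<in> A"
  shows "A = {s..<s + card A}"
proof (cases "A = {}")
  case False
  define m where "m = Max A"
  have "A = {s..m}"
    unfolding m_def
  proof (intro equalityI subsetI)
    fix v assume "v \<in> {s..Max A}"
    then show "v \<in> A"
      by (intro assms(3)[OF Max_in[OF assms(1) False]]) auto
  qed (use assms(2) Max_ge[OF assms(1)] in auto)
  moreover have "s \<le> m"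
    using assms(2) Max_in[OF assms(1) False] by (auto simp: m_def)
  ultimately show ?thesis
    by auto
qed simp

text \<open>The rank is defined as a cardinality; by down-closure the diagonal squares are
  consecutive, so their number is also the last index.\<close>

lemma diagonal_iff_le_rank:
  assumes "is_partition la"
  shows "(k, k) \<in> diagram la \<longleftrightarrow> 1 \<le> k \<and> k \<le> part_rank la"
proof -
  have "finite ((\<lambda>k. (k, k)) -` diagram la)"
    by (rule finite_vimageI[OF finite_diagram]) (auto simp: inj_def)
  then have "finite {k. (k, k) \<in> diagram la}"
    by (simp add: vimage_def)
  then have "{k. (k, k) \<in> diagram la} = {1..<1 + part_rank la}"
    unfolding part_rank_def
  proof (rule down_closed_eq_interval)
    show "{k. (k, k) \<in> diagram la} \<subseteq> {1..}"
      by (auto simp: diagram_def)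
  qed (auto intro: diagram_down_closed[OF assms])
  from eqset_imp_iff[OF this, of k] show ?thesis
    by auto
qed

text \<open>These are the order ideals of \<open>D\<close> in the componentwise order.
  \<open>D\<close> may be any set of squares, which covers arms and legs as well as
  \<lambda>(r,s).\<close>

definition down_sets :: "(nat \<times> nat) set \<Rightarrow> (nat \<times> nat) set set" where
  "down_sets D = {I. I \<subseteq> D \<and>
     (\<forall>u v u' v'. (u, v) \<in> I \<longrightarrow> (u', v') \<in> D \<longrightarrow> u' \<le> u \<longrightarrow> v' \<le> v \<longrightarrow> (u', v') \<in> I)}"

text \<open>One formula serves both sides of the factorization: on \<lambda>(r,s) it is the matrix
  entry, on an arm or a leg it is an entry of a triangular factor.\<close>

definition ideal_sum :: "(nat \<times> nat) set \<Rightarrow> xpoly" where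
  "ideal_sum D = (\<Sum>I \<in> down_sets D. \<Prod>p \<in> D - I. X p)"

lemma finite_down_sets: "finite D \<Longrightarrow> finite (down_sets D)"
  by (rule finite_subset[of _ "Pow D"]) (auto simp: down_sets_def)

lemma ideal_sum_empty: "ideal_sum {} = 1"
proof -
  have "down_sets {} = {{}}"
    by (auto simp: down_sets_def)
  then show ?thesis
    by (simp add: ideal_sum_def)
qed

section \<open>The bijection between partitions inside \<lambda>(r,s) and order ideals\<close>

lemma mem_diagram: "(Suc i, Suc j) \<in> diagram mu \<longleftrightarrow> i < length mu \<and> j < mu ! i"
  by (auto simp: diagram_def)

text \<open>The differences \<open>u - r\<close> and \<open>v - s\<close> count from 0, like list
  positions, while coordinates in a diagram count from 1. The lower bounds on \<open>u\<close> and
  \<open>v\<close> guard the truncated subtraction.\<close>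

lemma mem_placed:
  assumes "1 \<le> r" "1 \<le> s"
  shows "(u, v) \<in> placed mu r s \<longleftrightarrow>
    r \<le> u \<and> s \<le> v \<and> u - r < length mu \<and> v - s < mu ! (u - r)"
proof
  assume "(u, v) \<in> placed mu r s"
  then show "r \<le> u \<and> s \<le> v \<and> u - r < length mu \<and> v - s < mu ! (u - r)"
    using assms by (auto simp: placed_def diagram_def)
next
  assume *: "r \<le> u \<and> s \<le> v \<and> u - r < length mu \<and> v - s < mu ! (u - r)"
  then have "(Suc (u - r), Suc (v - s)) \<in> diagram mu"
    by (simp add: mem_diagram)
  moreover have "(u, v) = (\<lambda>(u, v). (u + r - 1, v + s - 1)) (Suc (u - r), Suc (v - s))"
    using * by simp
  ultimately show "(u, v) \<in> placed mu r s"
    unfolding placed_def by (rule rev_image_eqI)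
qed

lemma placed_inj:
  assumes "1 \<le> r" "1 \<le> s" "is_partition mu" "is_partition nu" "placed mu r s = placed nu r s"
  shows "mu = nu"
proof -
  have *: "i < length mu \<and> j < mu ! i \<longleftrightarrow> i < length nu \<and> j < nu ! i" for i j
    using mem_placed[OF assms(1,2), of "r + i" "s + j" mu]
      mem_placed[OF assms(1,2), of "r + i" "s + j" nu] assms(5) by simp
  have pos: "i < length mu \<Longrightarrow> 0 < mu ! i" "i < length nu \<Longrightarrow> 0 < nu ! i" for i
    using assms(3,4) unfolding is_partition_def by (metis gr0I nth_mem)+
  \<comment> \<open>Parts are positive, so the first column, \<open>j = 0\<close>, recovers the
    number of parts.\<close>
  have len: "i < length mu \<longleftrightarrow> i < length nu" for i
    using *[of i 0] pos[of i] by auto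
  then have "length mu = length nu"
    by (meson linorder_neqE_nat less_irrefl)
  moreover have "mu ! i = nu ! i" if "i < length mu" for i
    using *[of i] that len[of i] by (meson linorder_neqE_nat less_irrefl)
  ultimately show ?thesis
    by (rule nth_equalityI)
qed

lemma placed_in_down_sets:
  assumes "1 \<le> r" "1 \<le> s" "mu \<in> parts_in la r s"
  shows "placed mu r s \<in> down_sets (subdiagram la r s)"
proof -
  have mu: "is_partition mu" "placed mu r s \<subseteq> subdiagram la r s"
    using assms(3) by (auto simp: parts_in_def)
  have "(u', v') \<in> placed mu r s"
    if "(u, v) \<in> placed mu r s" "(u', v') \<in> subdiagram la r s" "u' \<le> u" "v' \<le> v" for u v u' v'
  proof -
    have "(Suc (u - r), Suc (v - s)) \<in> diagram mu"
      using that(1) by (simp add: mem_placed[OF assms(1,2)] mem_diagram)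
    then have "(Suc (u' - r), Suc (v' - s)) \<in> diagram mu"
      by (rule diagram_down_closed[OF mu(1)]) (use that in auto)
    then show ?thesis
      using that(2) by (simp add: mem_placed[OF assms(1,2)] mem_diagram subdiagram_def)
  qed
  with mu(2) show ?thesis
    by (auto simp: down_sets_def)
qed

text \<open>Each row of \<open>I\<close> is an interval starting in column \<open>s\<close>; the row
  lengths are the parts, and column \<open>s\<close> counts the nonempty rows.\<close>

lemma down_set_is_placed:
  assumes "is_partition la" "1 \<le> r" "1 \<le> s" "I \<in> down_sets (subdiagram la r s)"
  obtains mu where "mu \<in> parts_in la r s" "placed mu r s = I"
proof -
  have sub: "I \<subseteq> subdiagram la r s"
    using assms(4) by (simp add: down_sets_def)
  have fin: "finite I"
    by (rule finite_subset[OF _ finite_diagram[of la]]) (use sub in \<open>auto simp: subdiagram_def\<close>)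
  have down: "(u', v') \<in> I" if "(u, v) \<in> I" "r \<le> u'" "u' \<le> u" "s \<le> v'" "v' \<le> v" for u v u' v'
  proof -
    have "(u, v) \<in> diagram la"
      using that(1) sub by (auto simp: subdiagram_def)
    then have "(u', v') \<in> diagram la"
      by (rule diagram_down_closed[OF assms(1)]) (use assms that in auto)
    then show ?thesis
      using assms(4) that unfolding down_sets_def subdiagram_def by blast
  qed
  have ge: "r \<le> u" "s \<le> v" if "(u, v) \<in> I" for u v
    using that sub by (auto simp: subdiagram_def)
  define h where "h u = card {v. (u, v) \<in> I}" for u
  define n where "n = card {u. (u, s) \<in> I}"
  have row: "{v. (u, v) \<in> I} = {s..<s + h u}" for u
    unfolding h_def
  proof (rule down_closed_eq_interval)
    show "finite {v. (u, v) \<in> I}"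
      by (rule finite_subset[OF _ finite_imageI[OF fin, of snd]]) force
  qed (use ge down in blast)+
  have col: "{u. (u, s) \<in> I} = {r..<r + n}"
    unfolding n_def
  proof (rule down_closed_eq_interval)
    show "finite {u. (u, s) \<in> I}"
      by (rule finite_subset[OF _ finite_imageI[OF fin, of fst]]) force
  qed (use ge down in blast)+
  have mem_row: "(u, v) \<in> I \<longleftrightarrow> s \<le> v \<and> v < s + h u" for u v
    using eqset_imp_iff[OF row, of v u] by simp
  have mem_col: "(u, s) \<in> I \<longleftrightarrow> r \<le> u \<and> u < r + n" for u
    using eqset_imp_iff[OF col, of u] by simp
  define mu where "mu = map (\<lambda>i. h (r + i)) [0..<n]"
  \<comment> \<open>A longer lower row would contain a square in the first column missing from row
    \<open>r + i\<close>; down-closure would then force that column into row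
    \<open>r + i\<close>.\<close>
  have anti: "h (r + j) \<le> h (r + i)" if "i < j" for i j
  proof (rule ccontr)
    assume "\<not> h (r + j) \<le> h (r + i)"
    then have "(r + j, s + h (r + i)) \<in> I"
      by (simp add: mem_row)
    then have "(r + i, s + h (r + i)) \<in> I"
      by (rule down) (use that in auto)
    then show False
      by (simp add: mem_row)
  qed
  have pos: "h (r + i) \<noteq> 0" if "i < n" for i
    using mem_col[of "r + i"] mem_row[of "r + i" s] that by simp
  have "is_partition mu"
    unfolding is_partition_def mu_def
    by (auto simp: sorted_wrt_iff_nth_less anti pos)
  moreover have placed: "placed mu r s = I"
  proof -
    have "(u, v) \<in> placed mu r s \<longleftrightarrow> (u, v) \<in> I" for u v
    proof
      assume "(u, v) \<in> placed mu r s"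
      then show "(u, v) \<in> I"
        using assms by (auto simp: mem_placed mem_row mu_def)
    next
      assume I: "(u, v) \<in> I"
      then have "(u, s) \<in> I"
        using down[OF I, of u s] ge[OF I] by simp
      then have "r \<le> u" "u - r < n"
        using mem_col[of u] by auto
      moreover have "s \<le> v" "v < s + h u"
        using I mem_row[of u v] by auto
      ultimately show "(u, v) \<in> placed mu r s"
        by (auto simp: mem_placed[OF assms(2,3)] mu_def)
    qed
    then show ?thesis
      by auto
  qed
  ultimately have "mu \<in> parts_in la r s"
    using sub by (simp add: parts_in_def)
  then show ?thesis
    using placed that by blast
qed

lemma P_entry_eq_ideal_sum:
  assumes "is_partition la" "1 \<le> r" "1 \<le> s"
  shows "P_entry la r s = ideal_sum (subdiagram la r s)"
proof -
  have "inj_on (\<lambda>mu. placed mu r s) (parts_in la r s)"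
    by (rule inj_onI) (auto simp: parts_in_def intro: placed_inj[OF assms(2,3)])
  moreover have "(\<lambda>mu. placed mu r s) ` parts_in la r s = down_sets (subdiagram la r s)"
  proof (intro equalityI subsetI)
    fix I assume "I \<in> down_sets (subdiagram la r s)"
    then show "I \<in> (\<lambda>mu. placed mu r s) ` parts_in la r s"
      by (metis down_set_is_placed[OF assms] imageI)
  qed (use placed_in_down_sets[OF assms(2,3)] in blast)
  ultimately show ?thesis
    unfolding P_entry_def ideal_sum_def by (intro sum.reindex_cong[symmetric]) auto
qed

section \<open>The factorization of the matrix\<close>

text \<open>The arguments are ordered like matrix indices: arms give the entries U_rk, legs the
  entries L_ks.\<close>

definition arm :: "nat list \<Rightarrow> nat \<Rightarrow> nat \<Rightarrow> (nat \<times> nat) set" where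
  "arm la r k = {(u, v) \<in> diagram la. r \<le> u \<and> u < k \<and> k \<le> v}"

definition leg :: "nat list \<Rightarrow> nat \<Rightarrow> nat \<Rightarrow> (nat \<times> nat) set" where
  "leg la k s = {(u, v) \<in> diagram la. s \<le> v \<and> v < k \<and> k \<le> u}"

lemma finite_arm: "finite (arm la r k)" and finite_leg: "finite (leg la k s)"
  and finite_subdiagram: "finite (subdiagram la r s)"
  by (rule finite_subset[OF _ finite_diagram[of la]];
      force simp: arm_def leg_def subdiagram_def)+

text \<open>For fixed \<open>k\<close>, sending \<open>I\<close> to
  \<open>(I \<inter> ?B, I \<inter> ?C)\<close> is a bijection with inverse
  \<open>J1 \<union> J2 \<union> ?Q\<close>. The weight splits accordingly, and the block
  \<open>?T\<close>, missing from every such \<open>I\<close>, contributes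
  \<open>A_entry la k k\<close>.\<close>

lemma sum_down_sets_first_missing:
  assumes la: "is_partition la" and rs: "1 \<le> r" "1 \<le> s"
    and k: "max r s \<le> k" "k \<le> part_rank la + 1"
  shows "(\<Sum>I | I \<in> down_sets (subdiagram la r s) \<and> (LEAST k. max r s \<le> k \<and> (k, k) \<notin> I) = k.
            \<Prod>p \<in> subdiagram la r s - I. X p)
       = ideal_sum (arm la r k) * A_entry la k k * ideal_sum (leg la k s)"
    (is "sum ?w ?S = _")
proof -
  let ?E = "subdiagram la r s" and ?B = "arm la r k" and ?C = "leg la k s"
  let ?T = "subdiagram la k k"
  let ?Q = "{r..<k} \<times> {s..<k}"
  let ?L = "\<lambda>I. LEAST k. max r s \<le> k \<and> (k, k) \<notin> I"
  have Q_sub: "?Q \<subseteq> ?E"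
  proof
    fix p assume "p \<in> ?Q"
    then obtain u v where p: "p = (u, v)" "r \<le> u" "u < k" "s \<le> v" "v < k"
      by auto
    \<comment> \<open>The existence of \<open>p\<close> forces \<open>r < k\<close>, so
      \<open>k - 1\<close> is a positive index not above the rank; the square
      \<open>(k - 1, k - 1)\<close> dominates the whole rectangle.\<close>
    then have "(k - 1, k - 1) \<in> diagram la"
      using k rs by (subst diagonal_iff_le_rank[OF la]) auto
    then have "(u, v) \<in> diagram la"
      by (rule diagram_down_closed[OF la]) (use p rs in auto)
    then show "p \<in> ?E"
      using p by (auto simp: subdiagram_def)
  qed
  have E_split: "?E = ?B \<union> ?C \<union> ?T \<union> ?Q"
  proof
    show "?E \<subseteq> ?B \<union> ?C \<union> ?T \<union> ?Q"
      by (auto simp: subdiagram_def arm_def leg_def)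
    show "?B \<union> ?C \<union> ?T \<union> ?Q \<subseteq> ?E"
      using Q_sub k by (auto simp: subdiagram_def arm_def leg_def)
  qed
  have disj: "?B \<inter> ?C = {}" "?B \<inter> ?T = {}" "?C \<inter> ?T = {}" "?B \<inter> ?Q = {}" "?C \<inter> ?Q = {}" "?T \<inter> ?Q = {}"
    by (auto simp: subdiagram_def arm_def leg_def)
  have first: "(k, k) \<notin> I" "\<And>j. max r s \<le> j \<Longrightarrow> j < k \<Longrightarrow> (j, j) \<in> I" if "I \<in> ?S" for I
  proof -
    have I: "I \<in> down_sets ?E" "?L I = k"
      using that by auto
    \<comment> \<open>This square lies outside \<lambda>, so the set whose least element defines
      \<open>?L I\<close> is nonempty and \<open>LeastI\<close> applies.\<close>
    have "(part_rank la + 1, part_rank la + 1) \<notin> I"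
      using I(1) diagonal_iff_le_rank[OF la, of "part_rank la + 1"]
      by (auto simp: down_sets_def subdiagram_def)
    then have "max r s \<le> part_rank la + 1 \<and> (part_rank la + 1, part_rank la + 1) \<notin> I"
      using k by simp
    then have "max r s \<le> ?L I \<and> (?L I, ?L I) \<notin> I"
      by (rule LeastI[of "\<lambda>k. max r s \<le> k \<and> (k, k) \<notin> I"])
    then show "(k, k) \<notin> I"
      using I(2) by simp
    show "(j, j) \<in> I" if "max r s \<le> j" "j < k" for j
      using not_less_Least[of j "\<lambda>k. max r s \<le> k \<and> (k, k) \<notin> I"] I(2) that by auto
  qed
  have struct: "I \<inter> ?T = {}" "?Q \<subseteq> I" if "I \<in> ?S" for I
  proof -
    have I: "I \<subseteq> ?E" "\<And>u v u' v'. (u, v) \<in> I \<Longrightarrow> (u', v') \<in> ?E \<Longrightarrow> u' \<le> u \<Longrightarrow> v' \<le> v \<Longrightarrow> (u', v') \<in> I"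
      using that unfolding down_sets_def by blast+
    show "I \<inter> ?T = {}"
    proof (rule ccontr)
      assume "I \<inter> ?T \<noteq> {}"
      then obtain u v where uv: "(u, v) \<in> I" "(u, v) \<in> diagram la" "k \<le> u" "k \<le> v"
        by (auto simp: subdiagram_def)
      then have "(k, k) \<in> ?E"
        using diagram_down_closed[OF la uv(2), of k k] k rs by (auto simp: subdiagram_def)
      then have "(k, k) \<in> I"
        using I(2) uv by blast
      then show False
        using first(1)[OF that] by simp
    qed
    show "?Q \<subseteq> I"
    proof
      fix p assume p: "p \<in> ?Q"
      show "p \<in> I"
      \<comment> \<open>If \<open>k = max r s\<close>, the rectangle is empty; otherwise
        \<open>(k - 1, k - 1)\<close> belongs to \<open>I\<close> and dominates it.\<close>
      proof (cases "max r s = k")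
        case True
        then show ?thesis
          using p by (auto simp: max_def split: if_splits)
      next
        case False
        then have "max r s < k"
          using k by linarith
        then have "(k - 1, k - 1) \<in> I"
          using rs by (intro first(2)[OF that]) auto
        moreover have "p \<in> ?E"
          using p Q_sub by blast
        moreover have "fst p \<le> k - 1" "snd p \<le> k - 1"
          using p by auto
        ultimately show ?thesis
          using I(2)[of "k - 1" "k - 1" "fst p" "snd p"] by simp
      qed
    qed
  qed
  have restrict: "I \<inter> ?B \<in> down_sets ?B" "I \<inter> ?C \<in> down_sets ?C" if "I \<in> ?S" for I
  proof -
    have I: "I \<in> down_sets ?E"
      using that by simp
    have "?B \<subseteq> ?E" "?C \<subseteq> ?E"
      using E_split by auto
    then show "I \<inter> ?B \<in> down_sets ?B" "I \<inter> ?C \<in> down_sets ?C"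
      using I unfolding down_sets_def by blast+
  qed
  have glue: "J1 \<union> J2 \<union> ?Q \<in> ?S" if J1: "J1 \<in> down_sets ?B" and J2: "J2 \<in> down_sets ?C" for J1 J2
  proof -
    have sub: "J1 \<subseteq> ?B" "J2 \<subseteq> ?C"
      using J1 J2 by (auto simp: down_sets_def)
    have "J1 \<union> J2 \<union> ?Q \<in> down_sets ?E"
      unfolding down_sets_def
    proof (intro CollectI conjI allI impI)
      show "J1 \<union> J2 \<union> ?Q \<subseteq> ?E"
        using sub E_split by blast
      fix u v u' v'
      assume uv: "(u, v) \<in> J1 \<union> J2 \<union> ?Q" and E: "(u', v') \<in> ?E" and le: "u' \<le> u" "v' \<le> v"
      have T: "(u', v') \<notin> ?T"
        using uv le sub by (auto simp: arm_def leg_def subdiagram_def)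
      consider "(u', v') \<in> ?B" | "(u', v') \<in> ?C" | "(u', v') \<in> ?Q"
        using E T E_split by blast
      then show "(u', v') \<in> J1 \<union> J2 \<union> ?Q"
      proof cases
        case 1
        \<comment> \<open>Only squares of \<open>J1\<close> reach column \<open>k\<close>, so
          \<open>(u, v)\<close> lies in the same arm as \<open>(u', v')\<close>. This is why arm and
          leg do not constrain each other; the leg case is symmetric.\<close>
        then have "(u, v) \<in> J1"
          using uv le sub by (auto simp: arm_def leg_def)
        then show ?thesis
          using J1 1 le unfolding down_sets_def by blast
      next
        case 2
        then have "(u, v) \<in> J2"
          using uv le sub by (auto simp: arm_def leg_def)
        then show ?thesis
          using J2 2 le unfolding down_sets_def by blast
      qed blast
    qed
    moreover have "?L (J1 \<union> J2 \<union> ?Q) = k"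
    proof (rule Least_equality)
      show "max r s \<le> k \<and> (k, k) \<notin> J1 \<union> J2 \<union> ?Q"
        using sub k by (auto simp: arm_def leg_def)
      \<comment> \<open>The diagonal squares with index from \<open>max r s\<close> to
        \<open>k - 1\<close> all lie in \<open>?Q\<close>.\<close>
      fix j assume "max r s \<le> j \<and> (j, j) \<notin> J1 \<union> J2 \<union> ?Q"
      then show "k \<le> j"
        by auto
    qed
    ultimately show ?thesis
      by simp
  qed
  have weight: "?w (J1 \<union> J2 \<union> ?Q) = (\<Prod>p \<in> ?B - J1. X p) * A_entry la k k * (\<Prod>p \<in> ?C - J2. X p)"
    if J: "J1 \<in> down_sets ?B" "J2 \<in> down_sets ?C" for J1 J2
  proof -
    have sub: "J1 \<subseteq> ?B" "J2 \<subseteq> ?C"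
      using J by (auto simp: down_sets_def)
    have "?E - (J1 \<union> J2 \<union> ?Q) = ((?B - J1) \<union> ?T) \<union> (?C - J2)"
      using sub E_split disj by blast
    also have "(\<Prod>p \<in> \<dots>. X p) = (\<Prod>p \<in> (?B - J1) \<union> ?T. X p) * (\<Prod>p \<in> ?C - J2. X p)"
      by (rule prod.union_disjoint)
        (use disj in \<open>auto simp: finite_arm finite_leg finite_subdiagram\<close>)
    also have "(\<Prod>p \<in> (?B - J1) \<union> ?T. X p) = (\<Prod>p \<in> ?B - J1. X p) * (\<Prod>p \<in> ?T. X p)"
      by (rule prod.union_disjoint)
        (use disj in \<open>auto simp: finite_arm finite_leg finite_subdiagram\<close>)
    finally show ?thesis
      by (simp add: A_entry_def)
  qed
  have "ideal_sum ?B * A_entry la k k * ideal_sum ?C =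
      (\<Sum>(J1, J2) \<in> down_sets ?B \<times> down_sets ?C.
        (\<Prod>p \<in> ?B - J1. X p) * A_entry la k k * (\<Prod>p \<in> ?C - J2. X p))"
    unfolding ideal_sum_def sum.cartesian_product[symmetric]
    by (simp only: sum_distrib_left sum_distrib_right mult.assoc) (rule sum.swap)
  also have "\<dots> = sum ?w ?S"
  proof (rule sum.reindex_bij_witness[where i = "\<lambda>I. (I \<inter> ?B, I \<inter> ?C)" and j = "\<lambda>(J1, J2). J1 \<union> J2 \<union> ?Q"])
    fix J assume "J \<in> down_sets ?B \<times> down_sets ?C"
    then obtain J1 J2 where J: "J = (J1, J2)" "J1 \<in> down_sets ?B" "J2 \<in> down_sets ?C"
      by auto
    then have sub: "J1 \<subseteq> ?B" "J2 \<subseteq> ?C"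
      by (simp_all add: down_sets_def)
    have "(J1 \<union> J2 \<union> ?Q) \<inter> ?B = J1" "(J1 \<union> J2 \<union> ?Q) \<inter> ?C = J2"
      using sub disj(1,4,5) by blast+
    then show "(\<lambda>I. (I \<inter> ?B, I \<inter> ?C)) (case J of (J1, J2) \<Rightarrow> J1 \<union> J2 \<union> ?Q) = J"
      using J(1) by simp
    show "(case J of (J1, J2) \<Rightarrow> J1 \<union> J2 \<union> ?Q) \<in> ?S"
      using glue[OF J(2,3)] J(1) by simp
    show "?w (case J of (J1, J2) \<Rightarrow> J1 \<union> J2 \<union> ?Q) = (case J of (J1, J2) \<Rightarrow>
        (\<Prod>p \<in> ?B - J1. X p) * A_entry la k k * (\<Prod>p \<in> ?C - J2. X p))"
      using weight[OF J(2,3)] J(1) by simp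
  next
    fix I assume I: "I \<in> ?S"
    then have "I \<subseteq> ?E"
      by (simp add: down_sets_def)
    then have "I \<inter> ?B \<union> I \<inter> ?C \<union> ?Q = I"
      using struct[OF I] E_split by blast
    then show "(case (I \<inter> ?B, I \<inter> ?C) of (J1, J2) \<Rightarrow> J1 \<union> J2 \<union> ?Q) = I"
      by simp
    show "(I \<inter> ?B, I \<inter> ?C) \<in> down_sets ?B \<times> down_sets ?C"
      using restrict[OF I] by simp
  qed
  finally show ?thesis ..
qed

text \<open>Order ideals are grouped by their first missing diagonal square. The one with index
  \<open>part_rank la + 1\<close> is outside \<lambda> and hence always missing, which bounds the
  sum.\<close>

lemma P_entry_factorization:
  assumes la: "is_partition la" and rs: "1 \<le> r" "1 \<le> s" "r \<le> part_rank la + 1" "s \<le> part_rank la + 1"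
  shows "P_entry la r s = (\<Sum>k \<in> {max r s..part_rank la + 1}.
    ideal_sum (arm la r k) * A_entry la k k * ideal_sum (leg la k s))"
proof -
  let ?E = "subdiagram la r s"
  let ?L = "\<lambda>I. LEAST k. max r s \<le> k \<and> (k, k) \<notin> I"
  have range: "?L I \<in> {max r s..part_rank la + 1}" if "I \<in> down_sets ?E" for I
  proof -
    have *: "max r s \<le> part_rank la + 1 \<and> (part_rank la + 1, part_rank la + 1) \<notin> I"
      using that rs diagonal_iff_le_rank[OF la, of "part_rank la + 1"]
      by (auto simp: down_sets_def subdiagram_def)
    then show ?thesis
      using LeastI[of "\<lambda>k. max r s \<le> k \<and> (k, k) \<notin> I", OF *]
        Least_le[of "\<lambda>k. max r s \<le> k \<and> (k, k) \<notin> I", OF *] by simp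
  qed
  have "P_entry la r s = (\<Sum>I \<in> down_sets ?E. \<Prod>p \<in> ?E - I. X p)"
    using P_entry_eq_ideal_sum[OF la rs(1,2)] by (simp add: ideal_sum_def)
  also have "\<dots> = (\<Sum>k \<in> {max r s..part_rank la + 1}.
      \<Sum>I | I \<in> down_sets ?E \<and> ?L I = k. \<Prod>p \<in> ?E - I. X p)"
    by (rule sum.group[symmetric])
      (use range in \<open>auto simp: finite_down_sets finite_subdiagram\<close>)
  also have "\<dots> = (\<Sum>k \<in> {max r s..part_rank la + 1}.
      ideal_sum (arm la r k) * A_entry la k k * ideal_sum (leg la k s))"
    by (rule sum.cong[OF refl], rule sum_down_sets_first_missing[OF la rs(1,2)]) simp_all
  finally show ?thesis .
qed

section \<open>The polynomial ring of a partition\<close>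

lemma zero_in_poly_ring: "0 \<in> poly_ring la"
  by (simp add: poly_ring_def)

lemma one_in_poly_ring: "1 \<in> poly_ring la"
  by (simp add: poly_ring_def)

lemma X_in_poly_ring: "p \<in> diagram la \<Longrightarrow> X p \<in> poly_ring la"
  by (simp add: poly_ring_def X_def)

lemma uminus_in_poly_ring: "f \<in> poly_ring la \<Longrightarrow> - f \<in> poly_ring la"
  by (simp add: poly_ring_def)

lemma add_in_poly_ring: "f \<in> poly_ring la \<Longrightarrow> g \<in> poly_ring la \<Longrightarrow> f + g \<in> poly_ring la"
  using Poly_Mapping.keys_add[of f g] unfolding poly_ring_def by blast

lemma mult_in_poly_ring:
  assumes "f \<in> poly_ring la" "g \<in> poly_ring la"
  shows "f * g \<in> poly_ring la"
  unfolding poly_ring_def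
proof (intro CollectI ballI)
  fix m assume "m \<in> Poly_Mapping.keys (f * g)"
  then obtain a b where "m = a + b" "a \<in> Poly_Mapping.keys f" "b \<in> Poly_Mapping.keys g"
    using keys_mult[of f g] by blast
  then show "Poly_Mapping.keys m \<subseteq> diagram la"
    using assms Poly_Mapping.keys_add[of a b] unfolding poly_ring_def by blast
qed

lemma sum_in_poly_ring: "(\<And>x. x \<in> A \<Longrightarrow> f x \<in> poly_ring la) \<Longrightarrow> sum f A \<in> poly_ring la"
  by (induction A rule: infinite_finite_induct) (auto simp: zero_in_poly_ring add_in_poly_ring)

lemma prod_in_poly_ring: "(\<And>x. x \<in> A \<Longrightarrow> f x \<in> poly_ring la) \<Longrightarrow> prod f A \<in> poly_ring la"
  by (induction A rule: infinite_finite_induct) (auto simp: one_in_poly_ring mult_in_poly_ring)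

lemma ideal_sum_in_poly_ring: "D \<subseteq> diagram la \<Longrightarrow> ideal_sum D \<in> poly_ring la"
  unfolding ideal_sum_def
  by (intro sum_in_poly_ring prod_in_poly_ring X_in_poly_ring) auto

section \<open>Inverses of unitriangular matrices\<close>

text \<open>For fixed \<open>i\<close>, this solves V U = 1 column by column: the entry in column
  \<open>j\<close> is determined by the earlier ones when \<open>u j j = 1\<close>. The recursion
  does not depend on the matrix size.\<close>

fun unitri_inv :: "(nat \<Rightarrow> nat \<Rightarrow> 'a :: comm_ring_1) \<Rightarrow> nat \<Rightarrow> nat \<Rightarrow> 'a" where
  "unitri_inv u i j =
     (if j < i then 0 else if j = i then 1 else - (\<Sum>k \<in> {i..<j}. unitri_inv u i k * u k j))"

declare unitri_inv.simps [simp del]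

lemma unitri_inv_below: "j < i \<Longrightarrow> unitri_inv u i j = 0"
  and unitri_inv_diag: "unitri_inv u i i = 1"
  by (simp_all add: unitri_inv.simps)

text \<open>The recursion involves no division, so the inverse keeps its entries in the ring of
  \<lambda>, as \<open>SL\<close> demands.\<close>

lemma unitri_inv_closed:
  assumes "\<And>i j. u i j \<in> poly_ring la"
  shows "unitri_inv u i j \<in> poly_ring la"
proof (induction j rule: less_induct)
  case (less j)
  then show ?case
    by (subst unitri_inv.simps)
      (auto intro!: uminus_in_poly_ring sum_in_poly_ring mult_in_poly_ring assms
        simp: zero_in_poly_ring one_in_poly_ring)
qed

lemma sum_unitri_inv:
  assumes u: "\<And>i. u i i = 1" "\<And>i j. j < i \<Longrightarrow> u i j = 0" and "i < n" "j < n"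
  shows "(\<Sum>k \<in> {0..<n}. unitri_inv u i k * u k j) = (if i = j then 1 else 0)"
proof (cases "j < i")
  case True
  have "unitri_inv u i k * u k j = 0" for k
    using True u(2)[of j k] unitri_inv_below[of k i u] by (cases "k < i") auto
  then show ?thesis
    using True by simp
next
  case False
  \<comment> \<open>Outside \<open>{i..j}\<close> one of the two factors vanishes. For
    \<open>i < j\<close> the recursion makes the term \<open>k = j\<close> cancel the remaining
    ones.\<close>
  have "(\<Sum>k \<in> {0..<n}. unitri_inv u i k * u k j) = (\<Sum>k \<in> {i..j}. unitri_inv u i k * u k j)"
    by (rule sum.mono_neutral_right) (use assms in \<open>auto simp: not_le unitri_inv_below\<close>)
  also have "{i..j} = insert j {i..<j}"
    using False by auto
  also have "(\<Sum>k \<in> \<dots>. unitri_inv u i k * u k j) =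
      unitri_inv u i j + (\<Sum>k \<in> {i..<j}. unitri_inv u i k * u k j)"
    using u(1) by simp
  also have "\<dots> = (if i = j then 1 else 0)"
    using False by (subst unitri_inv.simps) auto
  finally show ?thesis .
qed

lemma upper_unitriangular_left_inverse:
  assumes "\<And>i. u i i = 1" "\<And>i j. j < i \<Longrightarrow> u i j = 0"
  shows "mat n n (\<lambda>(i, j). unitri_inv u i j) * mat n n (\<lambda>(i, j). u i j) = 1\<^sub>m n"
  by (rule eq_matI) (auto simp: scalar_prod_def sum_unitri_inv[of u, OF assms])

lemma upper_unitriangular_det:
  assumes "upper_unitriangular (B :: 'a :: comm_ring_1 mat)" "B \<in> carrier_mat n n"
  shows "Determinant.det B = 1"
proof -
  have "Determinant.det B = prod_list (diag_mat B)"
    using assms by (intro det_upper_triangular) (auto simp: upper_unitriangular_def)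
  also have "diag_mat B = replicate n 1"
    using assms by (auto simp: diag_mat_def upper_unitriangular_def intro!: nth_equalityI)
  finally show ?thesis
    by (simp add: prod_list_replicate)
qed

text \<open>The transpose is included because \<open>Q\<close> arises by transposing the inverse of
  the matrix of leg entries.\<close>

lemma unitri_inv_mat:
  assumes "\<And>i j. u i j \<in> poly_ring la"
  defines "V n \<equiv> mat n n (\<lambda>(i, j). unitri_inv u i j)"
  shows "upper_unitriangular (V n)" "V n \<in> SL n (poly_ring la)" "transpose_mat (V n) \<in> SL n (poly_ring la)"
proof -
  show up: "upper_unitriangular (V n)"
    by (auto simp: V_def upper_unitriangular_def unitri_inv_below unitri_inv_diag)
  have V: "V n \<in> carrier_mat n n"
    by (simp add: V_def)
  have "Determinant.det (V n) = 1"
    using up V by (rule upper_unitriangular_det)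
  moreover from this have "Determinant.det (transpose_mat (V n)) = 1"
    using det_transpose[OF V] by simp
  moreover have "elements_mat (V n) \<subseteq> poly_ring la" "elements_mat (transpose_mat (V n)) \<subseteq> poly_ring la"
    using unitri_inv_closed[OF assms(1)] by (auto simp: V_def elements_mat_def)
  ultimately show "V n \<in> SL n (poly_ring la)" "transpose_mat (V n) \<in> SL n (poly_ring la)"
    using V by (simp_all add: SL_def)
qed

lemma det_mat_diag: "Determinant.det (mat_diag n f) = (\<Prod>i \<in> {0..<n}. f i :: 'a :: comm_ring_1)"
proof -
  have "Determinant.det (mat_diag n f) = prod_list (diag_mat (mat_diag n f))"
    by (rule det_upper_triangular[of _ n]) (auto simp: mat_diag_def)
  also have "diag_mat (mat_diag n f) = map f [0..<n]"
    by (auto simp: diag_mat_def mat_diag_def)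
  finally show ?thesis
    by (simp add: prod.distinct_set_conv_list[symmetric])
qed

section \<open>Diagonalization\<close>

text \<open>Indices are shifted to start at 0. The case distinction matters: below the diagonal the
  arm is empty, and its \<open>ideal_sum\<close> would be 1 instead of 0.\<close>

definition arm_entry :: "nat list \<Rightarrow> nat \<Rightarrow> nat \<Rightarrow> xpoly" where
  "arm_entry la i k = (if k < i then 0 else ideal_sum (arm la (i + 1) (k + 1)))"

text \<open>This is the transpose of the lower triangular factor.\<close>

definition leg_entry :: "nat list \<Rightarrow> nat \<Rightarrow> nat \<Rightarrow> xpoly" where
  "leg_entry la j k = (if k < j then 0 else ideal_sum (leg la (k + 1) (j + 1)))"

lemma arm_entry_unitriangular: "arm_entry la i i = 1" "k < i \<Longrightarrow> arm_entry la i k = 0"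
  and leg_entry_unitriangular: "leg_entry la i i = 1" "k < i \<Longrightarrow> leg_entry la i k = 0"
proof -
  have "arm la (i + 1) (i + 1) = {}" "leg la (i + 1) (i + 1) = {}"
    by (auto simp: arm_def leg_def)
  then show "arm_entry la i i = 1" "leg_entry la i i = 1"
    by (simp_all add: arm_entry_def leg_entry_def ideal_sum_empty)
qed (simp_all add: arm_entry_def leg_entry_def)

lemma arm_entry_in_poly_ring: "arm_entry la i k \<in> poly_ring la"
  and leg_entry_in_poly_ring: "leg_entry la j k \<in> poly_ring la"
  by (auto simp: arm_entry_def leg_entry_def arm_def leg_def zero_in_poly_ring
      intro!: ideal_sum_in_poly_ring)

lemma M11_factorization:
  assumes "is_partition la" and n: "n = part_rank la + 1"
  shows "M11 la = mat n n (\<lambda>(i, k). arm_entry la i k) *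
    mat_diag n (\<lambda>i. A_entry la (i + 1) (i + 1)) * transpose_mat (mat n n (\<lambda>(j, k). leg_entry la j k))"
    (is "_ = ?R")
proof (rule eq_matI)
  fix i j assume "i < dim_row ?R" "j < dim_col ?R"
  then have ij: "i < Suc (part_rank la)" "j < Suc (part_rank la)"
    by (simp_all add: n)
  have "P_entry la (Suc i) (Suc j) = (\<Sum>k \<in> {max (Suc i) (Suc j)..Suc (part_rank la)}.
      ideal_sum (arm la (Suc i) k) * A_entry la k k * ideal_sum (leg la k (Suc j)))"
    using P_entry_factorization[OF assms(1), of "Suc i" "Suc j"] ij by simp
  also have "\<dots> = (\<Sum>k \<in> {max i j..part_rank la}.
      ideal_sum (arm la (Suc i) (Suc k)) * A_entry la (Suc k) (Suc k) * ideal_sum (leg la (Suc k) (Suc j)))"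
    unfolding max_Suc_Suc sum.shift_bounds_cl_Suc_ivl ..
  also have "\<dots> = (\<Sum>k \<in> {max i j..part_rank la}.
      arm_entry la i k * A_entry la (Suc k) (Suc k) * leg_entry la j k)"
    by (rule sum.cong) (auto simp: arm_entry_def leg_entry_def)
  \<comment> \<open>Terms with \<open>k < max i j\<close> can be added, since one of the two
    triangular factors is 0 there.\<close>
  also have "\<dots> = (\<Sum>k \<in> {0..<Suc (part_rank la)}.
      arm_entry la i k * A_entry la (Suc k) (Suc k) * leg_entry la j k)"
    by (rule sum.mono_neutral_left) (auto simp: arm_entry_def leg_entry_def)
  finally have "P_entry la (Suc i) (Suc j) = \<dots>" .
  moreover have "mat n n (\<lambda>(i, k). arm_entry la i k) * mat_diag n (\<lambda>i. A_entry la (i + 1) (i + 1)) =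
      mat n n (\<lambda>(i, k). arm_entry la i k * A_entry la (k + 1) (k + 1))"
    by (subst mat_diag_mult_right[of _ n n]) (auto intro!: eq_matI)
  ultimately show "M11 la $$ (i, j) = ?R $$ (i, j)"
    using ij n by (simp add: M11_def scalar_prod_def)
qed (simp_all add: M11_def n)

theorem theorem1:
  fixes la :: "nat list" and \<rho> :: nat
  assumes "is_partition la"
    and "\<rho> = part_rank la"
  shows "(\<exists>P \<in> SL (\<rho> + 1) (poly_ring la). \<exists>Q \<in> SL (\<rho> + 1) (poly_ring la).
            upper_unitriangular P \<and> lower_unitriangular Q \<and>
            P * M11 la * Q = mat_diag (\<rho> + 1) (\<lambda>i. A_entry la (i + 1) (i + 1)))
       \<and> Determinant.det (M11 la) = (\<Prod>i = 1..\<rho>. A_entry la i i)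
       \<and> A_entry la (\<rho> + 1) (\<rho> + 1) = 1"
proof -
  define n where "n = \<rho> + 1"
  define U where "U = mat n n (\<lambda>(i, k). arm_entry la i k)"
  define L where "L = mat n n (\<lambda>(j, k). leg_entry la j k)"
  define D where "D = mat_diag n (\<lambda>i. A_entry la (i + 1) (i + 1))"
  define P where "P = mat n n (\<lambda>(i, j). unitri_inv (arm_entry la) i j)"
  define V where "V = mat n n (\<lambda>(i, j). unitri_inv (leg_entry la) i j)"
  define Q where "Q = transpose_mat V"
  have carrier: "U \<in> carrier_mat n n" "L \<in> carrier_mat n n" "D \<in> carrier_mat n n"
    "P \<in> carrier_mat n n" "V \<in> carrier_mat n n" "Q \<in> carrier_mat n n" "transpose_mat L \<in> carrier_mat n n"
    by (simp_all add: U_def L_def D_def P_def V_def Q_def)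
  have P: "P \<in> SL n (poly_ring la)" "upper_unitriangular P"
    using unitri_inv_mat[OF arm_entry_in_poly_ring] by (simp_all add: P_def)
  have V: "transpose_mat V \<in> SL n (poly_ring la)" "upper_unitriangular V"
    using unitri_inv_mat[OF leg_entry_in_poly_ring] by (simp_all add: V_def)
  then have Q: "Q \<in> SL n (poly_ring la)" "lower_unitriangular Q"
    by (simp_all add: Q_def lower_unitriangular_def)
  have PU: "P * U = 1\<^sub>m n"
    unfolding P_def U_def by (intro upper_unitriangular_left_inverse arm_entry_unitriangular)
  have "V * L = 1\<^sub>m n"
    unfolding V_def L_def by (intro upper_unitriangular_left_inverse leg_entry_unitriangular)
  \<comment> \<open>Transposition turns the left inverse of \<open>L\<close> into a right inverse of
    the lower triangular factor.\<close>
  then have LQ: "transpose_mat L * Q = 1\<^sub>m n"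
    using transpose_mult[OF carrier(5,2)] by (simp add: Q_def)
  have M: "M11 la = U * D * transpose_mat L"
    unfolding U_def D_def L_def by (rule M11_factorization) (simp_all add: assms n_def)
  have "P * M11 la * Q = (P * U) * D * (transpose_mat L * Q)"
    unfolding M using carrier by (simp add: assoc_mult_mat[of _ n n _ n _ n])
  then have PMQ: "P * M11 la * Q = D"
    using carrier by (simp add: PU LQ)
  have A_last: "A_entry la (\<rho> + 1) (\<rho> + 1) = 1"
  proof -
    have "subdiagram la (\<rho> + 1) (\<rho> + 1) = {}"
    proof (rule ccontr)
      assume "subdiagram la (\<rho> + 1) (\<rho> + 1) \<noteq> {}"
      then obtain u v where uv: "(u, v) \<in> diagram la" "\<rho> + 1 \<le> u" "\<rho> + 1 \<le> v"
        by (auto simp: subdiagram_def)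
      \<comment> \<open>A square of \<lambda> beyond this corner would put the corner itself into
        \<lambda>, contradicting the rank.\<close>
      have "(\<rho> + 1, \<rho> + 1) \<in> diagram la"
        by (rule diagram_down_closed[OF assms(1) uv(1)]) (use uv in auto)
      then show False
        using diagonal_iff_le_rank[OF assms(1)] assms(2) by simp
    qed
    then show ?thesis
      by (simp add: A_entry_def)
  qed
  have M_carrier: "M11 la \<in> carrier_mat n n"
    by (simp add: M11_def n_def assms(2))
  have "Determinant.det D = Determinant.det P * Determinant.det (M11 la) * Determinant.det Q"
    unfolding PMQ[symmetric] using carrier M_carrier by (simp add: det_mult[of _ n])
  then have "Determinant.det (M11 la) = Determinant.det D"
    using P(1) Q(1) by (simp add: SL_def)
  also have "\<dots> = (\<Prod>i \<in> {0..<n}. A_entry la (Suc i) (Suc i))"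
    by (simp add: D_def det_mat_diag)
  \<comment> \<open>The last diagonal entry of \<open>D\<close> is 1 and drops out.\<close>
  also have "\<dots> = (\<Prod>i \<in> {0..<\<rho>}. A_entry la (Suc i) (Suc i))"
    using A_last by (simp add: n_def)
  also have "\<dots> = (\<Prod>i = 1..\<rho>. A_entry la i i)"
    by (simp add: prod.atLeast1_atMost_eq lessThan_atLeast0)
  finally have "Determinant.det (M11 la) = (\<Prod>i = 1..\<rho>. A_entry la i i)" .
  moreover have "\<exists>P \<in> SL (\<rho> + 1) (poly_ring la). \<exists>Q \<in> SL (\<rho> + 1) (poly_ring la).
      upper_unitriangular P \<and> lower_unitriangular Q \<and>
      P * M11 la * Q = mat_diag (\<rho> + 1) (\<lambda>i. A_entry la (i + 1) (i + 1))"
    using P Q PMQ unfolding D_def n_def by blast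
  ultimately show ?thesis
    using A_last by blast
qed

end
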